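(* Let $X$ be a set with at least two elements and let $\theta$ be a permutation of $X$. Then $(\Pi(X),\mathscr P(X);\Gamma_\theta)$ is a cross-connection, where $\Gamma_\theta:\Pi(X)\to\Pi(X)$ is the functor defined by $\Gamma_\theta(\bar\pi)=\overline{\theta^{-1}(\pi)}$ on objects and $\Gamma_\theta(\eta^\ast)=(\theta\eta\theta^{-1})^\ast$ on morphisms.
   Context: All maps and morphisms are composed from left to right. Powerset category $\mathscr P(X)$: objects are the non-empty proper subsets of $X$; morphisms $A\to B$ are all functions; inclusions are set inclusions. Category of partitions $\Pi(X)$: a partition is non-identity if at least one block has more than one element. For a non-identity partition $\pi$, $\bar\pi$ is the set of all functions from (the set of blocks) $\pi$ to $X$. Objects are the $\bar\pi$; morphisms $\bar\pi_1\to\bar\pi_2$ are the maps $\eta^\ast:\alpha\mapsto\eta\alpha$ for functions $\eta:\pi_2\to\pi_1$. Write $\bar\pi_1\subseteq\bar\pi_2$ if every block of $\pi_2$ lies in a block of $\pi_1$; the inclusion $j(\bar\pi_1,\bar\pi_2)$ is $\nu^\ast$, where $\nu:\pi_2\to\pi_1$ sends each block to the block containing it. For a permutation $\theta$ and a partition $\pi$, $\theta^{-1}(\pi)=\{\theta^{-1}(A):A\in\pi\}$. For $\eta:\pi_2\to\pi_1$, $\theta\eta\theta^{-1}:\theta^{-1}(\pi_2)\to\theta^{-1}(\pi_1)$ is the block map $B\mapsto\theta^{-1}((\theta(B))\eta)$. For a category with subobjects, $\langle c\rangle$ denotes the full subcategory on the subobjects of $c$. A functor $F:\mathcal D\to\mathcal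 C$ is a local isomorphism if it is inclusion preserving, fully faithful, and for each object $c$ of $\mathcal D$ the restriction $F_{|\langle c\rangle}$ is an isomorphism of $\langle c\rangle$ onto $\langle F(c)\rangle$. Cross-connections: in general a cross-connection $(\mathcal D,\mathcal C;\Gamma)$ is a local isomorphism $\Gamma:\mathcal D\to N^\ast\mathcal C$ into the normal dual of $\mathcal C$ such that every object $c$ of $\mathcal C$ lies in the $M$-set $M\Gamma(d)$ for some object $d$ of $\mathcal D$. For $\mathcal C=\mathscr P(X)$, the normal dual $N^\ast\mathscr P(X)$ is identified with $\Pi(X)$ (the functor $H(e;-)$ of an idempotent transformation $e$ being identified with $\bar\pi_e$, $\pi_e$ the kernel partition of $e$), and the $M$-set of $\bar\pi$ is the set of cross-sections of $\pi$ (subsets of $X$ containing exactly one element of each block). Thus $(\Pi(X),\mathscr P(X);\Gamma)$ is a cross-connection when $\Gamma:\Pi(X)\to\Pi(X)$ is a local isomorphism such that for every object $A$ of $\mathscr P(X)$ there is an object $\bar\pi$ of $\Pi(X)$ with $A$ a cross-section of (the partition underlying) $\Gamma(\bar\pi)$. *)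

theory Defs
  imports Main "HOL-Library.FuncSet" "HOL-Library.Disjoint_Sets"
begin

section \<open>Categories with subobjects\<close>

text \<open>Composition is written from left to right: in \<open>cmp C f g\<close> the arrow \<open>f\<close> comes first.
  \<open>sub C a b\<close> is the relation "\<open>a\<close> is a subobject of \<open>b\<close>", and then \<open>incl C a b\<close> is the inclusion
  of \<open>a\<close> in \<open>b\<close>.\<close>

record ('o, 'm) cat =
  obj :: "'o set"
  arr :: "'m set"
  src :: "'m \<Rightarrow> 'o"
  tgt :: "'m \<Rightarrow> 'o"
  idt :: "'o \<Rightarrow> 'm"
  cmp :: "'m \<Rightarrow> 'm \<Rightarrow> 'm"
  sub :: "'o \<Rightarrow> 'o \<Rightarrow> bool"
  incl :: "'o \<Rightarrow> 'o \<Rightarrow> 'm"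

definition hom :: "('o, 'm) cat \<Rightarrow> 'o \<Rightarrow> 'o \<Rightarrow> 'm set" where
  "hom C a b = {f \<in> arr C. src C f = a \<and> tgt C f = b}"

locale category =
  fixes C :: "('o, 'm) cat"
  assumes src_obj: "f \<in> arr C \<Longrightarrow> src C f \<in> obj C"
    and tgt_obj: "f \<in> arr C \<Longrightarrow> tgt C f \<in> obj C"
    and idt_hom: "a \<in> obj C \<Longrightarrow> idt C a \<in> hom C a a"
    and cmp_hom: "f \<in> hom C a b \<Longrightarrow> g \<in> hom C b c \<Longrightarrow> cmp C f g \<in> hom C a c"
    and idt_cmp: "f \<in> hom C a b \<Longrightarrow> cmp C (idt C a) f = f"
    and cmp_idt: "f \<in> hom C a b \<Longrightarrow> cmp C f (idt C b) = f"
    and cmp_assoc: "f \<in> hom C a b \<Longrightarrow> g \<in> hom C b c \<Longrightarrow> h \<in> hom C c d \<Longrightarrow>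
      cmp C (cmp C f g) h = cmp C f (cmp C g h)"

text \<open>The inclusions form a subcategory on all objects that is a partial order, every inclusion
  is a monomorphism, and an arrow whose composite with an inclusion is an inclusion is itself
  an inclusion.\<close>

locale category_with_subobjects = category C for C :: "('o, 'm) cat" +
  assumes incl_hom: "a \<in> obj C \<Longrightarrow> b \<in> obj C \<Longrightarrow> sub C a b \<Longrightarrow> incl C a b \<in> hom C a b"
    and sub_refl: "a \<in> obj C \<Longrightarrow> sub C a a"
    and incl_self: "a \<in> obj C \<Longrightarrow> incl C a a = idt C a"
    and sub_antisym: "a \<in> obj C \<Longrightarrow> b \<in> obj C \<Longrightarrow> sub C a b \<Longrightarrow> sub C b a \<Longrightarrow> a = b"
    and sub_trans: "a \<in> obj C \<Longrightarrow> b \<in> obj C \<Longrightarrow> c \<in> obj C \<Longrightarrow>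
      sub C a b \<Longrightarrow> sub C b c \<Longrightarrow> sub C a c"
    and incl_cmp: "a \<in> obj C \<Longrightarrow> b \<in> obj C \<Longrightarrow> c \<in> obj C \<Longrightarrow>
      sub C a b \<Longrightarrow> sub C b c \<Longrightarrow> cmp C (incl C a b) (incl C b c) = incl C a c"
    and incl_mono: "b \<in> obj C \<Longrightarrow> c \<in> obj C \<Longrightarrow> sub C b c \<Longrightarrow>
      f \<in> hom C a b \<Longrightarrow> g \<in> hom C a b \<Longrightarrow>
      cmp C f (incl C b c) = cmp C g (incl C b c) \<Longrightarrow> f = g"
    and incl_factor: "a \<in> obj C \<Longrightarrow> b \<in> obj C \<Longrightarrow> c \<in> obj C \<Longrightarrow>
      sub C a c \<Longrightarrow> sub C b c \<Longrightarrow> f \<in> hom C a b \<Longrightarrow>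
      cmp C f (incl C b c) = incl C a c \<Longrightarrow> sub C a b \<and> f = incl C a b"

definition full_subcategory :: "('o, 'm) cat \<Rightarrow> 'o set \<Rightarrow> ('o, 'm) cat" where
  "full_subcategory C S =
     C\<lparr>obj := obj C \<inter> S, arr := {f \<in> arr C. src C f \<in> S \<and> tgt C f \<in> S}\<rparr>"

definition principal_ideal :: "('o, 'm) cat \<Rightarrow> 'o \<Rightarrow> ('o, 'm) cat" where
  "principal_ideal C c = full_subcategory C {a \<in> obj C. sub C a c}"


section \<open>Local isomorphisms and cross-connections\<close>

record ('o, 'm, 'p, 'n) ftr =
  fobj :: "'o \<Rightarrow> 'p"
  farr :: "'m \<Rightarrow> 'n"

definition is_functor :: "('o, 'm) cat \<Rightarrow> ('p, 'n) cat \<Rightarrow> ('o, 'm, 'p, 'n) ftr \<Rightarrow> bool" where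
  "is_functor D C F \<longleftrightarrow> category D \<and> category C \<and>
     (\<forall>a \<in> obj D. fobj F a \<in> obj C) \<and>
     (\<forall>a \<in> obj D. \<forall>b \<in> obj D. \<forall>f \<in> hom D a b. farr F f \<in> hom C (fobj F a) (fobj F b)) \<and>
     (\<forall>a \<in> obj D. farr F (idt D a) = idt C (fobj F a)) \<and>
     (\<forall>f \<in> arr D. \<forall>g \<in> arr D. tgt D f = src D g \<longrightarrow>
        farr F (cmp D f g) = cmp C (farr F f) (farr F g))"

definition inclusion_preserving ::
    "('o, 'm) cat \<Rightarrow> ('p, 'n) cat \<Rightarrow> ('o, 'm, 'p, 'n) ftr \<Rightarrow> bool" where
  "inclusion_preserving D C F \<longleftrightarrow>
     (\<forall>a \<in> obj D. \<forall>b \<in> obj D. sub D a b \<longrightarrow>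
        sub C (fobj F a) (fobj F b) \<and> farr F (incl D a b) = incl C (fobj F a) (fobj F b))"

definition fully_faithful ::
    "('o, 'm) cat \<Rightarrow> ('p, 'n) cat \<Rightarrow> ('o, 'm, 'p, 'n) ftr \<Rightarrow> bool" where
  "fully_faithful D C F \<longleftrightarrow>
     (\<forall>a \<in> obj D. \<forall>b \<in> obj D. bij_betw (farr F) (hom D a b) (hom C (fobj F a) (fobj F b)))"

definition category_iso ::
    "('o, 'm) cat \<Rightarrow> ('p, 'n) cat \<Rightarrow> ('o, 'm, 'p, 'n) ftr \<Rightarrow> bool" where
  "category_iso D C F \<longleftrightarrow> is_functor D C F \<and>
     bij_betw (fobj F) (obj D) (obj C) \<and> bij_betw (farr F) (arr D) (arr C)"

definition local_isomorphism ::
    "('o, 'm) cat \<Rightarrow> ('p, 'n) cat \<Rightarrow> ('o, 'm, 'p, 'n) ftr \<Rightarrow> bool" where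
  "local_isomorphism D C F \<longleftrightarrow>
     category_with_subobjects D \<and> category_with_subobjects C \<and>
     is_functor D C F \<and> inclusion_preserving D C F \<and> fully_faithful D C F \<and>
     (\<forall>c \<in> obj D. category_iso (principal_ideal D c) (principal_ideal C (fobj F c)) F)"

text \<open>Here \<open>N\<close> stands for the normal dual of \<open>C\<close> and \<open>M\<close> assigns to each object of \<open>N\<close> its \<open>M\<close>-set,
  a set of objects of \<open>C\<close>.  Both have to be supplied; below they are the partition category and
  \<open>M_set\<close>, with which the normal dual of a powerset category and its \<open>M\<close>-sets are identified.\<close>

definition cross_connection ::
    "('p, 'n) cat \<Rightarrow> ('o, 'm) cat \<Rightarrow> ('q, 'k) cat \<Rightarrow> ('q \<Rightarrow> 'o set)
       \<Rightarrow> ('p, 'n, 'q, 'k) ftr \<Rightarrow> bool" where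
  "cross_connection D C N M \<Gamma> \<longleftrightarrow>
     category_with_subobjects C \<and> local_isomorphism D N \<Gamma> \<and>
     (\<forall>c \<in> obj C. \<exists>d \<in> obj D. c \<in> M (fobj \<Gamma> d))"


section \<open>The powerset category\<close>

text \<open>A map between sets is a triple of its domain, an extensional function, and its codomain.
  Arrows of both categories below are such maps.\<close>

type_synonym 'b set_map = "'b set \<times> ('b \<Rightarrow> 'b) \<times> 'b set"

definition set_map_id :: "'b set \<Rightarrow> 'b set_map" where
  "set_map_id A = (A, \<lambda>x\<in>A. x, A)"

definition set_map_cmp :: "'b set_map \<Rightarrow> 'b set_map \<Rightarrow> 'b set_map" where
  "set_map_cmp f g = (fst f, compose (fst f) (fst (snd g)) (fst (snd f)), snd (snd g))"

definition powerset_category :: "'a set \<Rightarrow> ('a set, 'a set_map) cat" where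
  "powerset_category X =
     \<lparr>obj = {A. A \<subseteq> X \<and> A \<noteq> {} \<and> A \<noteq> X},
      arr = {(A, f, B) | A f B. A \<subseteq> X \<and> A \<noteq> {} \<and> A \<noteq> X \<and> B \<subseteq> X \<and> B \<noteq> {} \<and> B \<noteq> X \<and>
                              f \<in> A \<rightarrow>\<^sub>E B},
      src = fst,
      tgt = (\<lambda>f. snd (snd f)),
      idt = set_map_id,
      cmp = set_map_cmp,
      sub = (\<subseteq>),
      incl = (\<lambda>A B. (A, \<lambda>x\<in>A. x, B))\<rparr>"


section \<open>The category of partitions\<close>

definition nonid_partitions :: "'a set \<Rightarrow> 'a set set set" where
  "nonid_partitions X =
     {\<pi>. partition_on X \<pi> \<and> (\<exists>A \<in> \<pi>. \<exists>x \<in> A. \<exists>y \<in> A. x \<noteq> y)}"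

definition bar :: "'a set \<Rightarrow> 'a set set \<Rightarrow> ('a set \<Rightarrow> 'a) set" where
  "bar X \<pi> = \<pi> \<rightarrow>\<^sub>E X"

text \<open>For \<open>\<eta>\<close> from \<open>\<pi>\<^sub>2\<close> to \<open>\<pi>\<^sub>1\<close>, this is the map \<open>\<alpha> \<mapsto> \<eta>\<alpha>\<close> (first \<open>\<eta>\<close>, then \<open>\<alpha>\<close>) from
  \<open>bar X \<pi>\<^sub>1\<close> to \<open>bar X \<pi>\<^sub>2\<close>.\<close>

definition star :: "'a set \<Rightarrow> 'a set set \<Rightarrow> 'a set set \<Rightarrow> ('a set \<Rightarrow> 'a set)
    \<Rightarrow> ('a set \<Rightarrow> 'a) set_map" where
  "star X \<pi>\<^sub>1 \<pi>\<^sub>2 \<eta> = (bar X \<pi>\<^sub>1, \<lambda>\<alpha>\<in>bar X \<pi>\<^sub>1. compose \<pi>\<^sub>2 \<alpha> \<eta>, bar X \<pi>\<^sub>2)"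

text \<open>The partition underlying an object; it is unique if \<open>X\<close> has at least two elements.\<close>

definition part_of :: "'a set \<Rightarrow> ('a set \<Rightarrow> 'a) set \<Rightarrow> 'a set set" where
  "part_of X c = (THE \<pi>. \<pi> \<in> nonid_partitions X \<and> bar X \<pi> = c)"

definition block_incl :: "'a set set \<Rightarrow> 'a set set \<Rightarrow> 'a set \<Rightarrow> 'a set" where
  "block_incl \<pi>\<^sub>2 \<pi>\<^sub>1 = (\<lambda>B\<in>\<pi>\<^sub>2. THE A. A \<in> \<pi>\<^sub>1 \<and> B \<subseteq> A)"

definition partition_category ::
    "'a set \<Rightarrow> (('a set \<Rightarrow> 'a) set, ('a set \<Rightarrow> 'a) set_map) cat" where
  "partition_category X =
     \<lparr>obj = bar X ` nonid_partitions X,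
      arr = {star X \<pi>\<^sub>1 \<pi>\<^sub>2 \<eta> | \<pi>\<^sub>1 \<pi>\<^sub>2 \<eta>.
               \<pi>\<^sub>1 \<in> nonid_partitions X \<and> \<pi>\<^sub>2 \<in> nonid_partitions X \<and> \<eta> \<in> \<pi>\<^sub>2 \<rightarrow>\<^sub>E \<pi>\<^sub>1},
      src = fst,
      tgt = (\<lambda>f. snd (snd f)),
      idt = set_map_id,
      cmp = set_map_cmp,
      sub = (\<lambda>c\<^sub>1 c\<^sub>2. refines X (part_of X c\<^sub>2) (part_of X c\<^sub>1)),
      incl = (\<lambda>c\<^sub>1 c\<^sub>2. star X (part_of X c\<^sub>1) (part_of X c\<^sub>2)
                       (block_incl (part_of X c\<^sub>2) (part_of X c\<^sub>1)))\<rparr>"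

text \<open>The cross-sections of the partition underlying \<open>c\<close>.\<close>

definition M_set :: "'a set \<Rightarrow> ('a set \<Rightarrow> 'a) set \<Rightarrow> 'a set set" where
  "M_set X c = {A. A \<subseteq> X \<and> (\<forall>B \<in> part_of X c. \<exists>!x. x \<in> A \<and> x \<in> B)}"


section \<open>The functor induced by a permutation\<close>

definition perm_inv_part :: "'a set \<Rightarrow> ('a \<Rightarrow> 'a) \<Rightarrow> 'a set set \<Rightarrow> 'a set set" where
  "perm_inv_part X \<theta> \<pi> = {inv_into X \<theta> ` A | A. A \<in> \<pi>}"

text \<open>\<open>\<theta>\<eta>\<theta>\<^sup>-\<^sup>1\<close>, composed from left to right, for \<open>\<eta>\<close> with domain \<open>\<pi>\<^sub>2\<close>.\<close>

definition perm_conj :: "'a set \<Rightarrow> ('a \<Rightarrow> 'a) \<Rightarrow> 'a set set \<Rightarrow> ('a set \<Rightarrow> 'a set)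
    \<Rightarrow> 'a set \<Rightarrow> 'a set" where
  "perm_conj X \<theta> \<pi>\<^sub>2 \<eta> = (\<lambda>B\<in>perm_inv_part X \<theta> \<pi>\<^sub>2. inv_into X \<theta> ` \<eta> (\<theta> ` B))"

text \<open>The block map \<open>\<eta>\<close> with \<open>f = \<eta>\<^sup>*\<close>; it is unique if \<open>X\<close> has at least two elements.\<close>

definition block_map_of :: "'a set \<Rightarrow> ('a set \<Rightarrow> 'a) set_map \<Rightarrow> 'a set \<Rightarrow> 'a set" where
  "block_map_of X f =
     (let \<pi>\<^sub>1 = part_of X (fst f); \<pi>\<^sub>2 = part_of X (snd (snd f))
      in THE \<eta>. \<eta> \<in> \<pi>\<^sub>2 \<rightarrow>\<^sub>E \<pi>\<^sub>1 \<and> star X \<pi>\<^sub>1 \<pi>\<^sub>2 \<eta> = f)"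

definition Gamma :: "'a set \<Rightarrow> ('a \<Rightarrow> 'a) \<Rightarrow>
    (('a set \<Rightarrow> 'a) set, ('a set \<Rightarrow> 'a) set_map, ('a set \<Rightarrow> 'a) set, ('a set \<Rightarrow> 'a) set_map) ftr" where
  "Gamma X \<theta> =
     \<lparr>fobj = (\<lambda>c. bar X (perm_inv_part X \<theta> (part_of X c))),
      farr = (\<lambda>f. let \<pi>\<^sub>1 = part_of X (fst f); \<pi>\<^sub>2 = part_of X (snd (snd f))
                  in star X (perm_inv_part X \<theta> \<pi>\<^sub>1) (perm_inv_part X \<theta> \<pi>\<^sub>2)
                       (perm_conj X \<theta> \<pi>\<^sub>2 (block_map_of X f)))\<rparr>"

end

theory Submission
  imports Defs
begin

text \<open>Everything about \<open>\<Gamma>\<^sub>\<theta>\<close> reduces to block maps: as \<open>X\<close> has two points, \<open>\<pi>\<close> and \<open>\<eta>\<close> can be recovered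
  from \<open>bar X \<pi>\<close> and \<open>\<eta>\<^sup>*\<close>. Conjugation by \<open>\<theta>\<close> is then a bijection on non-identity partitions that
  preserves and reflects refinement, and a bijection on block maps, so \<open>\<Gamma>\<^sub>\<theta>\<close> is an automorphism of
  the partition category and in particular a local isomorphism. Since it is surjective on objects,
  a set \<open>A\<close> lies in some \<open>M\<close>-set of \<open>\<Gamma>\<^sub>\<theta>\<close> as soon as it is a cross-section of some non-identity
  partition.\<close>

section \<open>Full subcategories and local isomorphisms\<close>

lemma homI: "f \<in> arr C \<Longrightarrow> f \<in> hom C (src C f) (tgt C f)"
  by (simp add: hom_def)

lemma (in category) arr_eq_UN_hom: "arr C = (\<Union>(a, b) \<in> obj C \<times> obj C. hom C a b)"
  using src_obj tgt_obj by (auto simp: hom_def)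

lemma hom_full_subcategory:
  "hom (full_subcategory C S) a b = (if a \<in> S \<and> b \<in> S then hom C a b else {})"
  by (auto simp: hom_def full_subcategory_def)

lemma (in category) category_full_subcategory: "category (full_subcategory C S)"
proof (unfold_locales, unfold hom_full_subcategory, goal_cases)
  case (1 f) then show ?case using src_obj by (auto simp: full_subcategory_def)
next
  case (2 f) then show ?case using tgt_obj by (auto simp: full_subcategory_def)
next
  case (3 a) then show ?case using idt_hom by (auto simp: full_subcategory_def)
next
  case (4 f a b g c) then show ?case
    using cmp_hom by (auto simp: full_subcategory_def split: if_splits)
next
  case (5 f a b) then show ?case
    using idt_cmp by (auto simp: full_subcategory_def split: if_splits)
next
  case (6 f a b) then show ?case
    using cmp_idt by (auto simp: full_subcategory_def split: if_splits)
next
  case (7 f a b g c h d) then show ?case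
    using cmp_assoc by (auto simp: full_subcategory_def split: if_splits)
qed

text \<open>Arrows with equal images have images with equal endpoints, so injectivity on objects
  puts both arrows in one hom-set, where faithfulness applies. Every hom-set of \<open>C\<close>
  runs between images of objects of \<open>D\<close>, hence is reached by fullness.\<close>

lemma bij_betw_arr:
  assumes F: "is_functor D C F" "fully_faithful D C F"
    and obj: "bij_betw (fobj F) (obj D) (obj C)"
  shows "bij_betw (farr F) (arr D) (arr C)"
proof -
  interpret D: category D using F by (simp add: is_functor_def)
  interpret C: category C using F by (simp add: is_functor_def)
  have hom: "bij_betw (farr F) (hom D a b) (hom C (fobj F a) (fobj F b))"
    if "a \<in> obj D" "b \<in> obj D" for a b
    using F that by (simp add: fully_faithful_def)
  show ?thesis
  proof (rule bij_betw_imageI)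
    show "inj_on (farr F) (arr D)"
    proof (rule inj_onI)
      fix f g assume f: "f \<in> arr D" and g: "g \<in> arr D" and eq: "farr F f = farr F g"
      note objs = D.src_obj[OF f] D.tgt_obj[OF f] D.src_obj[OF g] D.tgt_obj[OF g]
      have "farr F f \<in> hom C (fobj F (src D f)) (fobj F (tgt D f))"
        using bij_betw_apply[OF hom homI[OF f]] objs by blast
      moreover have "farr F g \<in> hom C (fobj F (src D g)) (fobj F (tgt D g))"
        using bij_betw_apply[OF hom homI[OF g]] objs by blast
      ultimately have "fobj F (src D f) = fobj F (src D g)" "fobj F (tgt D f) = fobj F (tgt D g)"
        using eq by (auto simp: hom_def)
      then have "src D g = src D f" "tgt D g = tgt D f"
        using inj_onD[OF bij_betw_imp_inj_on[OF obj]] objs by metis+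
      then have "g \<in> hom D (src D f) (tgt D f)" using homI[OF g] by simp
      then show "f = g"
        using inj_onD[OF bij_betw_imp_inj_on[OF hom]] eq homI[OF f] objs by blast
    qed
    have "farr F ` arr D = (\<Union>(a, b) \<in> obj D \<times> obj D. hom C (fobj F a) (fobj F b))"
      using hom by (fastforce simp: D.arr_eq_UN_hom image_UN bij_betw_def)
    also have "\<dots> = (\<Union>(a, b) \<in> fobj F ` obj D \<times> fobj F ` obj D. hom C a b)"
      by auto
    finally show "farr F ` arr D = arr C"
      using obj by (simp add: C.arr_eq_UN_hom bij_betw_def)
  qed
qed

text \<open>Preservation of inclusions sends subobjects of \<open>c\<close> to subobjects of
  \<open>fobj F c\<close>; the functor laws are inherited because a full subcategory keeps the
  operations of the whole category.\<close>

lemma is_functor_principal_ideal: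
  assumes F: "is_functor D C F" "inclusion_preserving D C F" and c: "c \<in> obj D"
  shows "is_functor (principal_ideal D c) (principal_ideal C (fobj F c)) F"
proof -
  interpret D: category D using F by (simp add: is_functor_def)
  interpret C: category C using F by (simp add: is_functor_def)
  have obj: "fobj F a \<in> obj C \<and> sub C (fobj F a) (fobj F c)" if "a \<in> obj D" "sub D a c" for a
    using F c that by (auto simp: is_functor_def inclusion_preserving_def)
  have hom: "farr F f \<in> hom C (fobj F a) (fobj F b)"
    if "a \<in> obj D" "b \<in> obj D" "f \<in> hom D a b" for a b f
    using F that by (simp add: is_functor_def)
  show ?thesis
    unfolding is_functor_def principal_ideal_def hom_full_subcategory
  proof (intro conjI)
    show "category (full_subcategory D {a \<in> obj D. sub D a c})"
      by (rule D.category_full_subcategory)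
    show "category (full_subcategory C {a \<in> obj C. sub C a (fobj F c)})"
      by (rule C.category_full_subcategory)
  qed (use obj hom F(1) in \<open>auto simp: full_subcategory_def is_functor_def\<close>)
qed

text \<open>Reflection of \<open>sub\<close> makes the restrictions onto: a subobject of
  \<open>fobj F c\<close> is the image of some \<open>a\<close> by surjectivity on objects, and
  reflection puts \<open>a\<close> below \<open>c\<close>. Arrows follow by
  \<open>bij_betw_arr\<close>, as principal ideals are full.\<close>

lemma local_isomorphism_if_iso:
  assumes D: "category_with_subobjects D" and C: "category_with_subobjects C"
    and F: "is_functor D C F" "inclusion_preserving D C F" "fully_faithful D C F"
    and obj: "bij_betw (fobj F) (obj D) (obj C)"
    and sub: "\<And>a b. a \<in> obj D \<Longrightarrow> b \<in> obj D \<Longrightarrow> sub C (fobj F a) (fobj F b) \<Longrightarrow> sub D a b"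
  shows "local_isomorphism D C F"
proof -
  have "category_iso (principal_ideal D c) (principal_ideal C (fobj F c)) F"
    if c: "c \<in> obj D" for c
  proof -
    let ?D = "principal_ideal D c" and ?C = "principal_ideal C (fobj F c)"
    have ftr: "is_functor ?D ?C F"
      using F c by (simp add: is_functor_principal_ideal)
    have objs: "obj ?D = {a \<in> obj D. sub D a c}" "obj ?C = {a \<in> obj C. sub C a (fobj F c)}"
      by (auto simp: principal_ideal_def full_subcategory_def)
    have "sub C (fobj F a) (fobj F c) \<longleftrightarrow> sub D a c" if "a \<in> obj D" for a
      using sub F(2) c that by (auto simp: inclusion_preserving_def)
    then have "fobj F ` obj ?D = obj ?C"
      unfolding objs bij_betw_imp_surj_on[OF obj, symmetric] by auto
    moreover have "inj_on (fobj F) (obj ?D)"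
      using bij_betw_imp_inj_on[OF obj] by (rule inj_on_subset) (auto simp: objs)
    ultimately have bij: "bij_betw (fobj F) (obj ?D) (obj ?C)"
      by (simp add: bij_betw_def)
    have "fully_faithful ?D ?C F"
      unfolding fully_faithful_def
    proof (intro ballI)
      fix a b assume ab: "a \<in> obj ?D" "b \<in> obj ?D"
      then have "fobj F a \<in> obj ?C" "fobj F b \<in> obj ?C" using bij by (auto simp: bij_betw_def)
      then have "hom ?D a b = hom D a b"
        "hom ?C (fobj F a) (fobj F b) = hom C (fobj F a) (fobj F b)"
        using ab unfolding objs by (simp_all add: principal_ideal_def hom_full_subcategory)
      then show "bij_betw (farr F) (hom ?D a b) (hom ?C (fobj F a) (fobj F b))"
        using F(3) ab unfolding objs fully_faithful_def by simp
    qed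
    with ftr bij show ?thesis by (simp add: category_iso_def bij_betw_arr)
  qed
  with D C F show ?thesis by (simp add: local_isomorphism_def)
qed


section \<open>The powerset category\<close>

lemma hom_powerset_category:
  "hom (powerset_category X) A B =
     (if A \<in> obj (powerset_category X) \<and> B \<in> obj (powerset_category X)
      then (\<lambda>f. (A, f, B)) ` (A \<rightarrow>\<^sub>E B) else {})"
  by (auto simp: hom_def powerset_category_def)

lemma category_with_subobjects_powerset: "category_with_subobjects (powerset_category X)"
proof -
  let ?P = "powerset_category X"
  have ops: "idt ?P = set_map_id" "cmp ?P = set_map_cmp" "sub ?P = (\<subseteq>)"
    "incl ?P = (\<lambda>A B. (A, \<lambda>x\<in>A. x, B))" "src ?P = fst" "tgt ?P = (\<lambda>f. snd (snd f))"
    by (simp_all add: powerset_category_def)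
  show ?thesis
  proof (unfold_locales, unfold hom_powerset_category ops, goal_cases)
    case (1 f) then show ?case by (auto simp: powerset_category_def)
  next
    case (2 f) then show ?case by (auto simp: powerset_category_def)
  next
    case (3 a) then show ?case by (auto simp: set_map_id_def)
  next
    case (4 f a b g c) then show ?case
      by (auto simp: set_map_cmp_def compose_def PiE_iff split: if_splits)
  next
    case (5 f a b) then show ?case
      by (auto simp: set_map_cmp_def set_map_id_def compose_def PiE_iff fun_eq_iff extensional_def
          split: if_splits)
  next
    case (6 f a b) then show ?case
      by (auto simp: set_map_cmp_def set_map_id_def compose_def PiE_iff fun_eq_iff extensional_def
          split: if_splits)
  next
    case (7 f a b g c h d) then show ?case
      by (auto simp: set_map_cmp_def compose_def PiE_iff fun_eq_iff split: if_splits)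
  next
    case (8 a b) then show ?case by (auto intro!: image_eqI[where x = "\<lambda>x\<in>a. x"])
  next
    case (13 a b c) then show ?case by (auto simp: set_map_cmp_def compose_def fun_eq_iff)
  next
    case (14 b c f a g)
    then obtain f' g' where fg: "f = (a, f', b)" "g = (a, g', b)" "f' \<in> a \<rightarrow>\<^sub>E b" "g' \<in> a \<rightarrow>\<^sub>E b"
      by (auto split: if_splits)
    have "f' x = g' x" if "x \<in> a" for x
      using 14(6) fg that
      by (auto simp: set_map_cmp_def compose_def PiE_iff Pi_iff dest!: fun_cong[of _ _ x])
    with fg show ?case by (auto intro: PiE_ext)
  next
    case (15 a b c f)
    then obtain f' where f: "f = (a, f', b)" "f' \<in> a \<rightarrow>\<^sub>E b"
      by (auto split: if_splits)
    \<comment> \<open>Inclusions do not change values, so \<open>f'\<close> fixes every point of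
      \<open>a\<close>; since its values lie in \<open>b\<close>, this also forces
      \<open>a \<subseteq> b\<close>.\<close>
    have "f' x = x" if "x \<in> a" for x
      using 15(7) f that by (auto simp: set_map_cmp_def compose_def PiE_iff dest!: fun_cong[of _ _ x])
    with f have "f' = (\<lambda>x\<in>a. x)" "a \<subseteq> b" by (auto simp: PiE_iff extensional_def fun_eq_iff)
    with f show ?case by simp
  qed (auto simp: set_map_id_def)
qed


section \<open>The category of partitions\<close>

lemma nonid_partitionsD: "\<pi> \<in> nonid_partitions X \<Longrightarrow> partition_on X \<pi>"
  by (simp add: nonid_partitions_def)

lemma block_subset: "\<pi> \<in> nonid_partitions X \<Longrightarrow> A \<in> \<pi> \<Longrightarrow> A \<subseteq> X"
  by (auto dest!: nonid_partitionsD simp: partition_on_def)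

section \<open>Block inclusions of a partition in a coarser one\<close>

lemma partition_on_block_eq:
  assumes "partition_on X \<pi>" "A \<in> \<pi>" "A' \<in> \<pi>" "x \<in> A" "x \<in> A'"
  shows "A = A'"
  using assms by (auto simp: partition_on_def disjoint_def)

text \<open>\<open>B\<close> is non-empty and a point of it lies in only one block of
  \<open>\<pi>\<^sub>1\<close>, so the definite description has a unique solution.\<close>

lemma block_incl_eq:
  assumes \<pi>: "partition_on X \<pi>\<^sub>1" "partition_on X \<pi>\<^sub>2" and AB: "B \<in> \<pi>\<^sub>2" "A \<in> \<pi>\<^sub>1" "B \<subseteq> A"
  shows "block_incl \<pi>\<^sub>2 \<pi>\<^sub>1 B = A"
proof -
  obtain x where x: "x \<in> B" using \<pi>(2) AB(1) by (metis partition_on_def equals0I)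
  have "(THE A. A \<in> \<pi>\<^sub>1 \<and> B \<subseteq> A) = A"
    using AB x partition_on_block_eq[OF \<pi>(1)] by (intro the_equality) blast+
  then show ?thesis using AB by (simp add: block_incl_def)
qed

lemma block_incl_PiE:
  assumes "refines X \<pi>\<^sub>2 \<pi>\<^sub>1"
  shows "block_incl \<pi>\<^sub>2 \<pi>\<^sub>1 \<in> \<pi>\<^sub>2 \<rightarrow>\<^sub>E \<pi>\<^sub>1"
proof (rule PiE_I)
  fix B assume B: "B \<in> \<pi>\<^sub>2"
  with assms obtain A where "A \<in> \<pi>\<^sub>1" "B \<subseteq> A" by (auto simp: refines_def)
  with assms B show "block_incl \<pi>\<^sub>2 \<pi>\<^sub>1 B \<in> \<pi>\<^sub>1" by (auto simp: refines_def block_incl_eq)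
qed (simp add: block_incl_def)

lemma subset_block_incl:
  assumes "refines X \<pi>\<^sub>2 \<pi>\<^sub>1" "B \<in> \<pi>\<^sub>2"
  shows "B \<subseteq> block_incl \<pi>\<^sub>2 \<pi>\<^sub>1 B"
proof -
  obtain A where "A \<in> \<pi>\<^sub>1" "B \<subseteq> A" using assms by (auto simp: refines_def)
  with assms show ?thesis by (auto simp: refines_def block_incl_eq)
qed

text \<open>Only one block of \<open>\<pi>\<^sub>1\<close> can contain a given \<open>B\<close>, so
  containment alone determines the block map. Identities, composites and conjugates are recognised
  as inclusions through this criterion.\<close>

lemma block_incl_unique:
  assumes \<pi>: "partition_on X \<pi>\<^sub>1" "partition_on X \<pi>\<^sub>2"
    and \<eta>: "\<eta> \<in> \<pi>\<^sub>2 \<rightarrow>\<^sub>E \<pi>\<^sub>1" "\<And>B. B \<in> \<pi>\<^sub>2 \<Longrightarrow> B \<subseteq> \<eta> B"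
  shows "\<eta> = block_incl \<pi>\<^sub>2 \<pi>\<^sub>1"
proof
  fix B
  show "\<eta> B = block_incl \<pi>\<^sub>2 \<pi>\<^sub>1 B"
  proof (cases "B \<in> \<pi>\<^sub>2")
    case True
    with \<eta> have "\<eta> B \<in> \<pi>\<^sub>1" "B \<subseteq> \<eta> B" by auto
    with True show ?thesis by (simp add: block_incl_eq[OF \<pi>])
  next
    case False
    with \<eta> show ?thesis by (auto simp: block_incl_def)
  qed
qed

section \<open>Arrows induced by block maps\<close>

lemma star_simps [simp]:
  "fst (star X \<pi>\<^sub>1 \<pi>\<^sub>2 \<eta>) = bar X \<pi>\<^sub>1" "snd (snd (star X \<pi>\<^sub>1 \<pi>\<^sub>2 \<eta>)) = bar X \<pi>\<^sub>2"
  by (simp_all add: star_def)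

lemma set_map_id_bar: "set_map_id (bar X \<pi>) = star X \<pi> \<pi> (\<lambda>A\<in>\<pi>. A)"
  by (auto simp: set_map_id_def star_def bar_def compose_def fun_eq_iff PiE_iff extensional_def)

lemma compose_bar: "\<alpha> \<in> bar X \<pi>\<^sub>1 \<Longrightarrow> \<eta> \<in> \<pi>\<^sub>2 \<rightarrow>\<^sub>E \<pi>\<^sub>1 \<Longrightarrow> compose \<pi>\<^sub>2 \<alpha> \<eta> \<in> bar X \<pi>\<^sub>2"
  by (auto simp: bar_def compose_def)

text \<open>Starring reverses direction: \<open>\<alpha>\<close> first becomes
  \<open>\<alpha>\<close> preceded by \<open>\<eta>\<close>, and this is then preceded by
  \<open>\<zeta>\<close>. Accordingly \<open>compose \<pi>\<^sub>3 \<eta> \<zeta>\<close> applies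
  \<open>\<zeta>\<close> first.\<close>

lemma set_map_cmp_star:
  assumes "\<eta> \<in> \<pi>\<^sub>2 \<rightarrow>\<^sub>E \<pi>\<^sub>1" "\<zeta> \<in> \<pi>\<^sub>3 \<rightarrow>\<^sub>E \<pi>\<^sub>2"
  shows "set_map_cmp (star X \<pi>\<^sub>1 \<pi>\<^sub>2 \<eta>) (star X \<pi>\<^sub>2 \<pi>\<^sub>3 \<zeta>) = star X \<pi>\<^sub>1 \<pi>\<^sub>3 (compose \<pi>\<^sub>3 \<eta> \<zeta>)"
proof -
  have "compose (bar X \<pi>\<^sub>1) (\<lambda>\<alpha>\<in>bar X \<pi>\<^sub>2. compose \<pi>\<^sub>3 \<alpha> \<zeta>) (\<lambda>\<alpha>\<in>bar X \<pi>\<^sub>1. compose \<pi>\<^sub>2 \<alpha> \<eta>) \<alpha>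
      = (\<lambda>\<alpha>\<in>bar X \<pi>\<^sub>1. compose \<pi>\<^sub>3 \<alpha> (compose \<pi>\<^sub>3 \<eta> \<zeta>)) \<alpha>" for \<alpha>
    using assms compose_bar[of \<alpha> X \<pi>\<^sub>1 \<eta> \<pi>\<^sub>2] by (auto simp: compose_def fun_eq_iff)
  then show ?thesis by (auto simp: set_map_cmp_def star_def)
qed

lemma compose_restrict_id: "f \<in> extensional A \<Longrightarrow> compose A f (\<lambda>x\<in>A. x) = f"
  by (auto simp: compose_def extensional_def)

lemma compose_PiE: "\<eta> \<in> \<pi>\<^sub>2 \<rightarrow>\<^sub>E \<pi>\<^sub>1 \<Longrightarrow> \<zeta> \<in> \<pi>\<^sub>3 \<rightarrow>\<^sub>E \<pi>\<^sub>2 \<Longrightarrow> compose \<pi>\<^sub>3 \<eta> \<zeta> \<in> \<pi>\<^sub>3 \<rightarrow>\<^sub>E \<pi>\<^sub>1"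
  by (auto simp: compose_def)

section \<open>Objects and arrows described by partitions and block maps\<close>

lemma obj_partition_category: "obj (partition_category X) = bar X ` nonid_partitions X"
  by (simp add: partition_category_def)

lemma hom_partition_categoryE:
  assumes "f \<in> hom (partition_category X) a b"
  obtains \<pi>\<^sub>1 \<pi>\<^sub>2 \<eta> where "\<pi>\<^sub>1 \<in> nonid_partitions X" "\<pi>\<^sub>2 \<in> nonid_partitions X" "\<eta> \<in> \<pi>\<^sub>2 \<rightarrow>\<^sub>E \<pi>\<^sub>1"
    "a = bar X \<pi>\<^sub>1" "b = bar X \<pi>\<^sub>2" "f = star X \<pi>\<^sub>1 \<pi>\<^sub>2 \<eta>"
  using assms by (auto simp: hom_def partition_category_def)

lemma idt_partition_category [simp]:
  "idt (partition_category X) (bar X \<pi>) = star X \<pi> \<pi> (\<lambda>A\<in>\<pi>. A)"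
  by (simp add: partition_category_def set_map_id_bar)

lemma cmp_partition_category [simp]:
  assumes "\<eta> \<in> \<pi>\<^sub>2 \<rightarrow>\<^sub>E \<pi>\<^sub>1" "\<zeta> \<in> \<pi>\<^sub>3 \<rightarrow>\<^sub>E \<pi>\<^sub>2"
  shows "cmp (partition_category X) (star X \<pi>\<^sub>1 \<pi>\<^sub>2 \<eta>) (star X \<pi>\<^sub>2 \<pi>\<^sub>3 \<zeta>) =
    star X \<pi>\<^sub>1 \<pi>\<^sub>3 (compose \<pi>\<^sub>3 \<eta> \<zeta>)"
  using assms by (simp add: partition_category_def set_map_cmp_star)

text \<open>Members of \<open>bar X \<pi>\<close> are extensional, so \<open>\<pi>\<close> is
  exactly the set of arguments at which some member differs from \<open>undefined\<close>.\<close>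

lemma bar_inject:
  assumes "\<exists>x \<in> X. \<exists>y \<in> X. x \<noteq> y" "bar X \<pi> = bar X \<pi>'"
  shows "\<pi> = \<pi>'"
proof -
  \<comment> \<open>The value \<open>undefined\<close> may itself lie in \<open>X\<close>; of two
    distinct points at least one differs from it.\<close>
  obtain x where x: "x \<in> X" "x \<noteq> undefined" using assms(1) by metis
  have dom: "{A. \<exists>\<alpha>\<in>bar X \<rho>. \<alpha> A \<noteq> undefined} = \<rho>" for \<rho>
  proof -
    have "(\<lambda>A\<in>\<rho>. x) \<in> bar X \<rho>" using x by (simp add: bar_def)
    then have "A \<in> \<rho> \<Longrightarrow> \<exists>\<alpha>\<in>bar X \<rho>. \<alpha> A \<noteq> undefined" for A
      using x by (intro bexI[of _ "\<lambda>A\<in>\<rho>. x"]) simp_all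
    then show ?thesis by (auto simp: bar_def)
  qed
  have "\<pi> = {A. \<exists>\<alpha>\<in>bar X \<pi>. \<alpha> A \<noteq> undefined}" by (rule dom[symmetric])
  also have "\<dots> = \<pi>'" unfolding assms(2) by (rule dom)
  finally show ?thesis .
qed

lemma star_inject:
  assumes X: "\<exists>x \<in> X. \<exists>y \<in> X. x \<noteq> y"
    and \<eta>: "\<eta> \<in> \<pi>\<^sub>2 \<rightarrow>\<^sub>E \<pi>\<^sub>1" "\<eta>' \<in> \<pi>\<^sub>2 \<rightarrow>\<^sub>E \<pi>\<^sub>1"
    and eq: "star X \<pi>\<^sub>1 \<pi>\<^sub>2 \<eta> = star X \<pi>\<^sub>1 \<pi>\<^sub>2 \<eta>'"
  shows "\<eta> = \<eta>'"
proof (rule PiE_ext[OF \<eta>])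
  fix B assume B: "B \<in> \<pi>\<^sub>2"
  obtain x y where xy: "x \<in> X" "y \<in> X" "x \<noteq> y" using X by blast
  \<comment> \<open>This member of \<open>bar X \<pi>\<^sub>1\<close> takes the value
    \<open>x\<close> at the block \<open>\<eta> B\<close> only. Evaluating both arrows at it, and
    the results at \<open>B\<close>, therefore forces \<open>\<eta>' B = \<eta> B\<close>.\<close>
  let ?\<alpha> = "\<lambda>A\<in>\<pi>\<^sub>1. if A = \<eta> B then x else y"
  have "?\<alpha> \<in> bar X \<pi>\<^sub>1" using xy by (simp add: bar_def)
  moreover have "(\<lambda>\<alpha>\<in>bar X \<pi>\<^sub>1. compose \<pi>\<^sub>2 \<alpha> \<eta>) ?\<alpha> = (\<lambda>\<alpha>\<in>bar X \<pi>\<^sub>1. compose \<pi>\<^sub>2 \<alpha> \<eta>') ?\<alpha>"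
    using eq unfolding star_def prod.inject by metis
  ultimately have "compose \<pi>\<^sub>2 ?\<alpha> \<eta> B = compose \<pi>\<^sub>2 ?\<alpha> \<eta>' B" by simp
  moreover have "\<eta> B \<in> \<pi>\<^sub>1" "\<eta>' B \<in> \<pi>\<^sub>1" using \<eta> B by auto
  ultimately show "\<eta> B = \<eta>' B"
    using B xy by (simp add: compose_def split: if_splits)
qed

context
  fixes X :: "'a set"
  assumes two: "\<exists>x \<in> X. \<exists>y \<in> X. x \<noteq> y"
begin

lemma part_of_bar [simp]: "\<pi> \<in> nonid_partitions X \<Longrightarrow> part_of X (bar X \<pi>) = \<pi>"
  unfolding part_of_def by (rule the_equality) (auto dest: bar_inject[OF two])

lemma block_map_of_star [simp]:
  assumes "\<pi>\<^sub>1 \<in> nonid_partitions X" "\<pi>\<^sub>2 \<in> nonid_partitions X" "\<eta> \<in> \<pi>\<^sub>2 \<rightarrow>\<^sub>E \<pi>\<^sub>1"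
  shows "block_map_of X (star X \<pi>\<^sub>1 \<pi>\<^sub>2 \<eta>) = \<eta>"
proof -
  have "block_map_of X (star X \<pi>\<^sub>1 \<pi>\<^sub>2 \<eta>) =
      (THE \<zeta>. \<zeta> \<in> \<pi>\<^sub>2 \<rightarrow>\<^sub>E \<pi>\<^sub>1 \<and> star X \<pi>\<^sub>1 \<pi>\<^sub>2 \<zeta> = star X \<pi>\<^sub>1 \<pi>\<^sub>2 \<eta>)"
    using assms(1,2) by (simp add: block_map_of_def)
  also have "\<dots> = \<eta>"
    by (rule the_equality) (use assms(3) in \<open>auto dest: star_inject[OF two, rotated 2]\<close>)
  finally show ?thesis .
qed

lemma hom_partition_category:
  assumes "\<pi>\<^sub>1 \<in> nonid_partitions X" "\<pi>\<^sub>2 \<in> nonid_partitions X"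
  shows "hom (partition_category X) (bar X \<pi>\<^sub>1) (bar X \<pi>\<^sub>2) = star X \<pi>\<^sub>1 \<pi>\<^sub>2 ` (\<pi>\<^sub>2 \<rightarrow>\<^sub>E \<pi>\<^sub>1)"
proof (intro equalityI subsetI)
  fix f assume "f \<in> hom (partition_category X) (bar X \<pi>\<^sub>1) (bar X \<pi>\<^sub>2)"
  then obtain \<rho>\<^sub>1 \<rho>\<^sub>2 \<eta> where f: "f = star X \<rho>\<^sub>1 \<rho>\<^sub>2 \<eta>" "\<eta> \<in> \<rho>\<^sub>2 \<rightarrow>\<^sub>E \<rho>\<^sub>1"
    and "bar X \<rho>\<^sub>1 = bar X \<pi>\<^sub>1" "bar X \<rho>\<^sub>2 = bar X \<pi>\<^sub>2"
    by (auto simp: hom_def partition_category_def)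
  then have "\<rho>\<^sub>1 = \<pi>\<^sub>1" "\<rho>\<^sub>2 = \<pi>\<^sub>2" by (auto dest: bar_inject[OF two])
  with f show "f \<in> star X \<pi>\<^sub>1 \<pi>\<^sub>2 ` (\<pi>\<^sub>2 \<rightarrow>\<^sub>E \<pi>\<^sub>1)" by blast
qed (use assms in \<open>auto simp: hom_def partition_category_def\<close>)

lemma sub_partition_category [simp]:
  assumes "\<pi>\<^sub>1 \<in> nonid_partitions X" "\<pi>\<^sub>2 \<in> nonid_partitions X"
  shows "sub (partition_category X) (bar X \<pi>\<^sub>1) (bar X \<pi>\<^sub>2) \<longleftrightarrow> refines X \<pi>\<^sub>2 \<pi>\<^sub>1"
  using assms by (simp add: partition_category_def)

lemma incl_partition_category [simp]:
  assumes "\<pi>\<^sub>1 \<in> nonid_partitions X" "\<pi>\<^sub>2 \<in> nonid_partitions X"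
  shows "incl (partition_category X) (bar X \<pi>\<^sub>1) (bar X \<pi>\<^sub>2) = star X \<pi>\<^sub>1 \<pi>\<^sub>2 (block_incl \<pi>\<^sub>2 \<pi>\<^sub>1)"
  using assms by (simp add: partition_category_def)

section \<open>The axioms for the category of partitions\<close>

lemma category_partition: "category (partition_category X)"
proof (unfold_locales, goal_cases)
  case (1 f) then show ?case by (auto simp: partition_category_def)
next
  case (2 f) then show ?case by (auto simp: partition_category_def)
next
  case (3 a) then show ?case by (auto simp: obj_partition_category hom_partition_category)
next
  case (4 f a b g c)
  then show ?case
    \<comment> \<open>The representations of \<open>f\<close> and \<open>g\<close> each bring their
      own middle partition; \<open>bar_inject\<close> identifies the two.\<close>
    by (elim hom_partition_categoryE)
      (auto dest!: bar_inject[OF two] simp: hom_partition_category compose_PiE)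
next
  case (5 f a b)
  then show ?case
    by (elim hom_partition_categoryE) (simp add: Id_compose PiE_iff)
next
  case (6 f a b)
  then show ?case
    by (elim hom_partition_categoryE) (simp add: compose_restrict_id PiE_iff)
next
  case (7 f a b g c h d)
  then show ?case
    by (elim hom_partition_categoryE)
      (auto dest!: bar_inject[OF two] simp: compose_PiE, auto simp: compose_def fun_eq_iff
        intro!: arg_cong[of _ _ "star X _ _"])
qed

text \<open>Since starring reverses arrows, the monomorphism law asks that a block inclusion
  \<open>\<nu>\<close>, applied first, can be cancelled. This holds because \<open>\<nu>\<close> is
  onto: each coarser block has a point, and that point lies in some finer block.\<close>

lemma category_with_subobjects_partition: "category_with_subobjects (partition_category X)"
proof (rule category_with_subobjects.intro[OF category_partition], unfold_locales, goal_cases)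
  case (1 a b)
  then show ?case by (auto simp: obj_partition_category hom_partition_category block_incl_PiE)
next
  case (2 a)
  then show ?case
    by (auto simp: obj_partition_category refines_refl[OF nonid_partitionsD])
next
  case (3 a)
  then obtain \<pi> where \<pi>: "\<pi> \<in> nonid_partitions X" "a = bar X \<pi>"
    by (auto simp: obj_partition_category)
  then have "(\<lambda>A\<in>\<pi>. A) = block_incl \<pi> \<pi>"
    by (intro block_incl_unique[of X]) (auto dest: nonid_partitionsD)
  with \<pi> show ?case by simp
next
  case (4 a b)
  then show ?case by (auto simp: obj_partition_category dest: refines_asym)
next
  case (5 a b c)
  then show ?case by (auto simp: obj_partition_category intro: refines_trans)
next
  case (6 a b c)
  then obtain \<pi>\<^sub>1 \<pi>\<^sub>2 \<pi>\<^sub>3 where \<pi>: "\<pi>\<^sub>1 \<in> nonid_partitions X" "\<pi>\<^sub>2 \<in> nonid_partitions X"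
      "\<pi>\<^sub>3 \<in> nonid_partitions X" "a = bar X \<pi>\<^sub>1" "b = bar X \<pi>\<^sub>2" "c = bar X \<pi>\<^sub>3"
    and ref: "refines X \<pi>\<^sub>2 \<pi>\<^sub>1" "refines X \<pi>\<^sub>3 \<pi>\<^sub>2"
    by (auto simp: obj_partition_category)
  note ble = block_incl_PiE[OF ref(1)] block_incl_PiE[OF ref(2)]
  have "compose \<pi>\<^sub>3 (block_incl \<pi>\<^sub>2 \<pi>\<^sub>1) (block_incl \<pi>\<^sub>3 \<pi>\<^sub>2) = block_incl \<pi>\<^sub>3 \<pi>\<^sub>1"
  proof (rule block_incl_unique[of X])
    fix C assume C: "C \<in> \<pi>\<^sub>3"
    then have "block_incl \<pi>\<^sub>3 \<pi>\<^sub>2 C \<in> \<pi>\<^sub>2" using ble by auto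
    then show "C \<subseteq> compose \<pi>\<^sub>3 (block_incl \<pi>\<^sub>2 \<pi>\<^sub>1) (block_incl \<pi>\<^sub>3 \<pi>\<^sub>2) C"
      using subset_block_incl[OF ref(1)] subset_block_incl[OF ref(2) C] C
      by (fastforce simp: compose_def)
  qed (use \<pi> ble in \<open>simp_all add: compose_PiE nonid_partitionsD\<close>)
  with \<pi> ble show ?case by simp
next
  case (7 b c f a g)
  from 7(1,2,4,5) obtain \<pi>\<^sub>1 \<pi>\<^sub>2 \<pi>\<^sub>3 \<eta> \<eta>' where \<pi>: "\<pi>\<^sub>1 \<in> nonid_partitions X" "\<pi>\<^sub>2 \<in> nonid_partitions X"
      "\<pi>\<^sub>3 \<in> nonid_partitions X" "a = bar X \<pi>\<^sub>1" "b = bar X \<pi>\<^sub>2" "c = bar X \<pi>\<^sub>3"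
    and \<eta>: "\<eta> \<in> \<pi>\<^sub>2 \<rightarrow>\<^sub>E \<pi>\<^sub>1" "f = star X \<pi>\<^sub>1 \<pi>\<^sub>2 \<eta>" "\<eta>' \<in> \<pi>\<^sub>2 \<rightarrow>\<^sub>E \<pi>\<^sub>1" "g = star X \<pi>\<^sub>1 \<pi>\<^sub>2 \<eta>'"
    by (auto simp: obj_partition_category elim!: hom_partition_categoryE dest!: bar_inject[OF two])
  have ref: "refines X \<pi>\<^sub>3 \<pi>\<^sub>2" using 7(3) \<pi> by simp
  let ?\<nu> = "block_incl \<pi>\<^sub>3 \<pi>\<^sub>2"
  have \<nu>: "?\<nu> \<in> \<pi>\<^sub>3 \<rightarrow>\<^sub>E \<pi>\<^sub>2" by (rule block_incl_PiE[OF ref])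
  have "star X \<pi>\<^sub>1 \<pi>\<^sub>3 (compose \<pi>\<^sub>3 \<eta> ?\<nu>) = star X \<pi>\<^sub>1 \<pi>\<^sub>3 (compose \<pi>\<^sub>3 \<eta>' ?\<nu>)"
    using 7(6) \<pi> \<eta> \<nu> by simp
  then have eq: "compose \<pi>\<^sub>3 \<eta> ?\<nu> = compose \<pi>\<^sub>3 \<eta>' ?\<nu>"
    by (rule star_inject[OF two compose_PiE[OF \<eta>(1) \<nu>] compose_PiE[OF \<eta>(3) \<nu>]])
  have "\<eta> = \<eta>'"
  proof (rule PiE_ext[OF \<eta>(1,3)])
    fix B assume B: "B \<in> \<pi>\<^sub>2"
    obtain x where x: "x \<in> B" "x \<in> X"
      using B block_subset[OF \<pi>(2) B] nonid_partitionsD[OF \<pi>(2)]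
      by (metis partition_on_def equals0I subsetD)
    obtain C where C: "C \<in> \<pi>\<^sub>3" "x \<in> C"
      using x nonid_partitionsD[OF \<pi>(3)] by (auto simp: partition_on_def)
    \<comment> \<open>The block containing \<open>C\<close> shares the point \<open>x\<close> with
      \<open>B\<close>, and blocks that meet coincide.\<close>
    have "?\<nu> C = B"
      using partition_on_block_eq[OF nonid_partitionsD[OF \<pi>(2)], of "?\<nu> C" B x] B C x \<nu>
        subset_block_incl[OF ref C(1)] by auto
    then show "\<eta> B = \<eta>' B" using fun_cong[OF eq, of C] C by (simp add: compose_def)
  qed
  with \<eta> show ?case by simp
next
  case (8 a b c f)
  from 8(1,2,3,6) obtain \<pi>\<^sub>1 \<pi>\<^sub>2 \<pi>\<^sub>3 \<eta> where \<pi>: "\<pi>\<^sub>1 \<in> nonid_partitions X" "\<pi>\<^sub>2 \<in> nonid_partitions X"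
      "\<pi>\<^sub>3 \<in> nonid_partitions X" "a = bar X \<pi>\<^sub>1" "b = bar X \<pi>\<^sub>2" "c = bar X \<pi>\<^sub>3"
    and \<eta>: "\<eta> \<in> \<pi>\<^sub>2 \<rightarrow>\<^sub>E \<pi>\<^sub>1" "f = star X \<pi>\<^sub>1 \<pi>\<^sub>2 \<eta>"
    by (auto simp: obj_partition_category elim!: hom_partition_categoryE dest!: bar_inject[OF two])
  note part = nonid_partitionsD[OF \<pi>(1)] nonid_partitionsD[OF \<pi>(2)] nonid_partitionsD[OF \<pi>(3)]
  have ref: "refines X \<pi>\<^sub>3 \<pi>\<^sub>1" "refines X \<pi>\<^sub>3 \<pi>\<^sub>2" using 8(4,5) \<pi> by simp_all
  let ?\<nu> = "block_incl \<pi>\<^sub>3 \<pi>\<^sub>2"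
  have \<nu>: "?\<nu> \<in> \<pi>\<^sub>3 \<rightarrow>\<^sub>E \<pi>\<^sub>2" by (rule block_incl_PiE[OF ref(2)])
  have "star X \<pi>\<^sub>1 \<pi>\<^sub>3 (compose \<pi>\<^sub>3 \<eta> ?\<nu>) = star X \<pi>\<^sub>1 \<pi>\<^sub>3 (block_incl \<pi>\<^sub>3 \<pi>\<^sub>1)"
    using 8(7) \<pi> \<eta> \<nu> by simp
  then have eq: "compose \<pi>\<^sub>3 \<eta> ?\<nu> = block_incl \<pi>\<^sub>3 \<pi>\<^sub>1"
    by (rule star_inject[OF two compose_PiE[OF \<eta>(1) \<nu>] block_incl_PiE[OF ref(1)]])
  \<comment> \<open>Containment is checked pointwise. The block \<open>C\<close> of the finer
    partition through \<open>x\<close> satisfies \<open>?\<nu> C = B\<close>, so \<open>eq\<close>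
    identifies \<open>\<eta> B\<close> with the block of \<open>\<pi>\<^sub>1\<close> that contains
    \<open>C\<close>, and hence \<open>x\<close>.\<close>
  have sub: "B \<subseteq> \<eta> B" if B: "B \<in> \<pi>\<^sub>2" for B
  proof
    fix x assume x: "x \<in> B"
    then have "x \<in> X" using block_subset[OF \<pi>(2) B] by auto
    then obtain C where C: "C \<in> \<pi>\<^sub>3" "x \<in> C"
      using part(3) by (auto simp: partition_on_def)
    have "?\<nu> C = B"
      using partition_on_block_eq[OF part(2), of "?\<nu> C" B x] B C x \<nu>
        subset_block_incl[OF ref(2) C(1)] by auto
    then have "\<eta> B = block_incl \<pi>\<^sub>3 \<pi>\<^sub>1 C"
      using fun_cong[OF eq, of C] C by (simp add: compose_def)
    then show "x \<in> \<eta> B" using subset_block_incl[OF ref(1) C(1)] C by auto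
  qed
  then have "refines X \<pi>\<^sub>2 \<pi>\<^sub>1"
    using part \<eta>(1) by (auto simp: refines_def)
  moreover have "\<eta> = block_incl \<pi>\<^sub>2 \<pi>\<^sub>1"
    by (rule block_incl_unique[OF part(1,2) \<eta>(1) sub])
  ultimately show ?case using \<pi> \<eta> by simp
qed

end


section \<open>The functor of a permutation\<close>

text \<open>The bijection is arbitrary so that the result serves both \<open>\<theta>\<close> and
  its inverse.\<close>

lemma nonid_partitions_image:
  assumes \<phi>: "bij_betw \<phi> X X" and \<pi>: "\<pi> \<in> nonid_partitions X"
  shows "(`) \<phi> ` \<pi> \<in> nonid_partitions X"
proof -
  note inj = bij_betw_imp_inj_on[OF \<phi>]
  have "partition_on (\<phi> ` X) ((`) \<phi> ` \<pi> - {{}})"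
    using nonid_partitionsD[OF \<pi>] inj by (rule partition_on_inj_image)
  \<comment> \<open>The image partition is stated with the empty set removed; as no block is empty,
    nothing is removed.\<close>
  moreover have "{} \<notin> (`) \<phi> ` \<pi>" using nonid_partitionsD[OF \<pi>] by (auto simp: partition_on_def)
  ultimately have "partition_on X ((`) \<phi> ` \<pi>)" using \<phi> by (simp add: bij_betw_def)
  moreover obtain A x y where A: "A \<in> \<pi>" "x \<in> A" "y \<in> A" "x \<noteq> y"
    using \<pi> by (auto simp: nonid_partitions_def)
  then have "\<phi> x \<noteq> \<phi> y" using inj_onD[OF inj] block_subset[OF \<pi>] by blast
  with A have "\<exists>B \<in> (`) \<phi> ` \<pi>. \<exists>x \<in> B. \<exists>y \<in> B. x \<noteq> y" by blast
  ultimately show ?thesis by (simp add: nonid_partitions_def)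
qed

section \<open>Transport of partitions and block maps along a permutation\<close>

lemma perm_inv_part_eq_image: "perm_inv_part X \<theta> \<pi> = (`) (inv_into X \<theta>) ` \<pi>"
  by (auto simp: perm_inv_part_def)

context
  fixes X :: "'a set" and \<theta> :: "'a \<Rightarrow> 'a"
  assumes perm: "bij_betw \<theta> X X"
begin

lemma perm_image_inv [simp]: "A \<subseteq> X \<Longrightarrow> \<theta> ` inv_into X \<theta> ` A = A"
  using perm by (simp add: bij_betw_def image_inv_into_cancel)

lemma inv_image_perm [simp]: "A \<subseteq> X \<Longrightarrow> inv_into X \<theta> ` \<theta> ` A = A"
  using perm by (auto simp: bij_betw_def inv_into_image_cancel)

lemma inv_image_subset_iff:
  assumes "A \<subseteq> X" "B \<subseteq> X"
  shows "inv_into X \<theta> ` A \<subseteq> inv_into X \<theta> ` B \<longleftrightarrow> A \<subseteq> B"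
  using assms perm_image_inv image_mono by metis

lemma perm_inv_part_nonid:
  "\<pi> \<in> nonid_partitions X \<Longrightarrow> perm_inv_part X \<theta> \<pi> \<in> nonid_partitions X"
  using nonid_partitions_image[OF bij_betw_inv_into[OF perm]]
  by (simp add: perm_inv_part_eq_image)

text \<open>Taking blockwise images under \<open>\<theta>\<close> is the inverse. Surjectivity is
  also what later realises every non-identity partition as a value of the functor.\<close>

lemma bij_betw_perm_inv_part:
  "bij_betw (perm_inv_part X \<theta>) (nonid_partitions X) (nonid_partitions X)"
proof (rule bij_betw_byWitness[where f' = "(`) ((`) \<theta>)"])
  show "\<forall>\<pi> \<in> nonid_partitions X. (`) \<theta> ` perm_inv_part X \<theta> \<pi> = \<pi>"
    by (auto simp: perm_inv_part_eq_image image_iff block_subset)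
  show "\<forall>\<pi> \<in> nonid_partitions X. perm_inv_part X \<theta> ((`) \<theta> ` \<pi>) = \<pi>"
    by (auto simp: perm_inv_part_eq_image image_iff block_subset)
qed (use perm_inv_part_nonid nonid_partitions_image[OF perm] in auto)

text \<open>One direction gives preservation of subobjects, the other gives the reflection that
  \<open>local_isomorphism_if_iso\<close> requires.\<close>

lemma refines_perm_inv_part:
  assumes "\<pi>\<^sub>1 \<in> nonid_partitions X" "\<pi>\<^sub>2 \<in> nonid_partitions X"
  shows "refines X (perm_inv_part X \<theta> \<pi>\<^sub>2) (perm_inv_part X \<theta> \<pi>\<^sub>1) \<longleftrightarrow> refines X \<pi>\<^sub>2 \<pi>\<^sub>1"
  using assms[THEN nonid_partitionsD] assms[THEN perm_inv_part_nonid, THEN nonid_partitionsD]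
    assms[THEN block_subset]
  by (simp add: refines_def perm_inv_part_eq_image inv_image_subset_iff cong: ball_cong bex_cong)

lemma perm_conj_inv_image:
  assumes "\<pi>\<^sub>2 \<in> nonid_partitions X" "A \<in> \<pi>\<^sub>2"
  shows "perm_conj X \<theta> \<pi>\<^sub>2 \<eta> (inv_into X \<theta> ` A) = inv_into X \<theta> ` \<eta> A"
  using assms by (simp add: perm_conj_def perm_inv_part_eq_image block_subset)

lemma perm_conj_PiE:
  assumes "\<pi>\<^sub>2 \<in> nonid_partitions X" "\<eta> \<in> \<pi>\<^sub>2 \<rightarrow>\<^sub>E \<pi>\<^sub>1"
  shows "perm_conj X \<theta> \<pi>\<^sub>2 \<eta> \<in> perm_inv_part X \<theta> \<pi>\<^sub>2 \<rightarrow>\<^sub>E perm_inv_part X \<theta> \<pi>\<^sub>1"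
proof (rule PiE_I)
  fix B assume "B \<in> perm_inv_part X \<theta> \<pi>\<^sub>2"
  with assms show "perm_conj X \<theta> \<pi>\<^sub>2 \<eta> B \<in> perm_inv_part X \<theta> \<pi>\<^sub>1"
    by (auto simp: perm_inv_part_eq_image perm_conj_inv_image)
qed (simp add: perm_conj_def)

text \<open>Converse use of the evaluation rule: it characterises the conjugate among extensional
  maps. Surjectivity of conjugation and its behaviour on identities and composites are obtained this
  way.\<close>

lemma perm_conj_eqI:
  assumes \<pi>: "\<pi>\<^sub>2 \<in> nonid_partitions X" and \<zeta>: "\<zeta> \<in> extensional (perm_inv_part X \<theta> \<pi>\<^sub>2)"
    and eq: "\<And>A. A \<in> \<pi>\<^sub>2 \<Longrightarrow> \<zeta> (inv_into X \<theta> ` A) = inv_into X \<theta> ` \<eta> A"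
  shows "perm_conj X \<theta> \<pi>\<^sub>2 \<eta> = \<zeta>"
proof (rule extensionalityI[OF _ \<zeta>])
  show "perm_conj X \<theta> \<pi>\<^sub>2 \<eta> \<in> extensional (perm_inv_part X \<theta> \<pi>\<^sub>2)"
    by (simp add: perm_conj_def)
  show "perm_conj X \<theta> \<pi>\<^sub>2 \<eta> B = \<zeta> B" if "B \<in> perm_inv_part X \<theta> \<pi>\<^sub>2" for B
    using that eq \<pi> by (auto simp: perm_inv_part_eq_image perm_conj_inv_image)
qed

lemma bij_betw_perm_conj:
  assumes \<pi>: "\<pi>\<^sub>1 \<in> nonid_partitions X" "\<pi>\<^sub>2 \<in> nonid_partitions X"
  shows "bij_betw (perm_conj X \<theta> \<pi>\<^sub>2) (\<pi>\<^sub>2 \<rightarrow>\<^sub>E \<pi>\<^sub>1)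
    (perm_inv_part X \<theta> \<pi>\<^sub>2 \<rightarrow>\<^sub>E perm_inv_part X \<theta> \<pi>\<^sub>1)"
proof (rule bij_betw_imageI)
  show "inj_on (perm_conj X \<theta> \<pi>\<^sub>2) (\<pi>\<^sub>2 \<rightarrow>\<^sub>E \<pi>\<^sub>1)"
  proof (rule inj_onI)
    fix \<eta> \<eta>' assume \<eta>: "\<eta> \<in> \<pi>\<^sub>2 \<rightarrow>\<^sub>E \<pi>\<^sub>1" "\<eta>' \<in> \<pi>\<^sub>2 \<rightarrow>\<^sub>E \<pi>\<^sub>1"
      and eq: "perm_conj X \<theta> \<pi>\<^sub>2 \<eta> = perm_conj X \<theta> \<pi>\<^sub>2 \<eta>'"
    show "\<eta> = \<eta>'"
    proof (rule PiE_ext[OF \<eta>])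
      fix A assume A: "A \<in> \<pi>\<^sub>2"
      then have "inv_into X \<theta> ` \<eta> A = inv_into X \<theta> ` \<eta>' A"
        using perm_conj_inv_image[OF \<pi>(2)] eq by metis
      moreover have "\<eta> A \<subseteq> X" "\<eta>' A \<subseteq> X" using A \<eta> block_subset[OF \<pi>(1)] by blast+
      ultimately show "\<eta> A = \<eta>' A" using perm_image_inv by metis
    qed
  qed
  show "perm_conj X \<theta> \<pi>\<^sub>2 ` (\<pi>\<^sub>2 \<rightarrow>\<^sub>E \<pi>\<^sub>1) = perm_inv_part X \<theta> \<pi>\<^sub>2 \<rightarrow>\<^sub>E perm_inv_part X \<theta> \<pi>\<^sub>1"
  proof (intro equalityI subsetI)
    fix \<zeta> assume \<zeta>: "\<zeta> \<in> perm_inv_part X \<theta> \<pi>\<^sub>2 \<rightarrow>\<^sub>E perm_inv_part X \<theta> \<pi>\<^sub>1"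
    \<comment> \<open>The witness is \<open>\<zeta>\<close> conjugated by the inverse
      permutation.\<close>
    let ?\<eta> = "\<lambda>A\<in>\<pi>\<^sub>2. \<theta> ` \<zeta> (inv_into X \<theta> ` A)"
    \<comment> \<open>The value of \<open>\<zeta>\<close> is the inverse image of a block of
      \<open>\<pi>\<^sub>1\<close>. This shows both that the witness takes values in
      \<open>\<pi>\<^sub>1\<close> and that conjugating it back returns
      \<open>\<zeta>\<close>.\<close>
    have \<zeta>_block: "\<theta> ` \<zeta> (inv_into X \<theta> ` A) \<in> \<pi>\<^sub>1 \<and>
        inv_into X \<theta> ` \<theta> ` \<zeta> (inv_into X \<theta> ` A) = \<zeta> (inv_into X \<theta> ` A)" if "A \<in> \<pi>\<^sub>2" for A
    proof -
      have "\<zeta> (inv_into X \<theta> ` A) \<in> (`) (inv_into X \<theta>) ` \<pi>\<^sub>1"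
        using \<zeta> that by (simp add: perm_inv_part_eq_image PiE_iff)
      then obtain B where "B \<in> \<pi>\<^sub>1" "\<zeta> (inv_into X \<theta> ` A) = inv_into X \<theta> ` B" by blast
      with block_subset[OF \<pi>(1)] show ?thesis by simp
    qed
    then have "?\<eta> \<in> \<pi>\<^sub>2 \<rightarrow>\<^sub>E \<pi>\<^sub>1" by simp
    moreover have "perm_conj X \<theta> \<pi>\<^sub>2 ?\<eta> = \<zeta>"
    proof (rule perm_conj_eqI[OF \<pi>(2)])
      show "\<zeta> \<in> extensional (perm_inv_part X \<theta> \<pi>\<^sub>2)" using \<zeta> by (simp add: PiE_iff)
    qed (simp add: \<zeta>_block)
    ultimately show "\<zeta> \<in> perm_conj X \<theta> \<pi>\<^sub>2 ` (\<pi>\<^sub>2 \<rightarrow>\<^sub>E \<pi>\<^sub>1)" by (metis imageI)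
  qed (use perm_conj_PiE[OF \<pi>(2)] in blast)
qed

lemma perm_conj_id:
  "\<pi> \<in> nonid_partitions X \<Longrightarrow> perm_conj X \<theta> \<pi> (\<lambda>A\<in>\<pi>. A) = (\<lambda>A\<in>perm_inv_part X \<theta> \<pi>. A)"
  by (rule perm_conj_eqI) (auto simp: perm_inv_part_eq_image)

text \<open>The inverse permutation and \<open>\<theta>\<close> cancel between the two factors,
  because \<open>\<zeta> A\<close> is a block of \<open>\<pi>\<^sub>2\<close> and thus lies in
  \<open>X\<close>.\<close>

lemma perm_conj_compose:
  assumes "\<pi>\<^sub>2 \<in> nonid_partitions X" "\<pi>\<^sub>3 \<in> nonid_partitions X" "\<zeta> \<in> \<pi>\<^sub>3 \<rightarrow>\<^sub>E \<pi>\<^sub>2"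
  shows "perm_conj X \<theta> \<pi>\<^sub>3 (compose \<pi>\<^sub>3 \<eta> \<zeta>) =
    compose (perm_inv_part X \<theta> \<pi>\<^sub>3) (perm_conj X \<theta> \<pi>\<^sub>2 \<eta>) (perm_conj X \<theta> \<pi>\<^sub>3 \<zeta>)"
proof (rule perm_conj_eqI[OF assms(2)])
  fix A assume A: "A \<in> \<pi>\<^sub>3"
  then have "\<zeta> A \<in> \<pi>\<^sub>2" using assms(3) by auto
  with A assms show "compose (perm_inv_part X \<theta> \<pi>\<^sub>3) (perm_conj X \<theta> \<pi>\<^sub>2 \<eta>) (perm_conj X \<theta> \<pi>\<^sub>3 \<zeta>)
      (inv_into X \<theta> ` A) = inv_into X \<theta> ` compose \<pi>\<^sub>3 \<eta> \<zeta> A"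
    by (simp add: compose_def perm_conj_inv_image) (simp add: perm_inv_part_eq_image)
qed simp

text \<open>Taking images under the inverse preserves the containment of a block in its target, and
  \<open>block_incl_unique\<close> recognises the result.\<close>

lemma perm_conj_block_incl:
  assumes \<pi>: "\<pi>\<^sub>1 \<in> nonid_partitions X" "\<pi>\<^sub>2 \<in> nonid_partitions X" and ref: "refines X \<pi>\<^sub>2 \<pi>\<^sub>1"
  shows "perm_conj X \<theta> \<pi>\<^sub>2 (block_incl \<pi>\<^sub>2 \<pi>\<^sub>1) =
    block_incl (perm_inv_part X \<theta> \<pi>\<^sub>2) (perm_inv_part X \<theta> \<pi>\<^sub>1)"
proof (rule block_incl_unique[of X])
  fix B assume "B \<in> perm_inv_part X \<theta> \<pi>\<^sub>2"
  then obtain A where A: "A \<in> \<pi>\<^sub>2" "B = inv_into X \<theta> ` A" by (auto simp: perm_inv_part_eq_image)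
  then show "B \<subseteq> perm_conj X \<theta> \<pi>\<^sub>2 (block_incl \<pi>\<^sub>2 \<pi>\<^sub>1) B"
    using subset_block_incl[OF ref A(1)] by (auto simp: perm_conj_inv_image[OF \<pi>(2)])
qed (use \<pi> in \<open>simp_all add: perm_conj_PiE block_incl_PiE[OF ref] perm_inv_part_nonid
      nonid_partitionsD\<close>)

section \<open>The induced functor as an automorphism of the category of partitions\<close>

context
  assumes two: "\<exists>x \<in> X. \<exists>y \<in> X. x \<noteq> y"
begin

lemma fobj_Gamma:
  "\<pi> \<in> nonid_partitions X \<Longrightarrow> fobj (Gamma X \<theta>) (bar X \<pi>) = bar X (perm_inv_part X \<theta> \<pi>)"
  by (simp add: Gamma_def part_of_bar[OF two])

lemma farr_Gamma:
  assumes "\<pi>\<^sub>1 \<in> nonid_partitions X" "\<pi>\<^sub>2 \<in> nonid_partitions X" "\<eta> \<in> \<pi>\<^sub>2 \<rightarrow>\<^sub>E \<pi>\<^sub>1"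
  shows "farr (Gamma X \<theta>) (star X \<pi>\<^sub>1 \<pi>\<^sub>2 \<eta>) =
    star X (perm_inv_part X \<theta> \<pi>\<^sub>1) (perm_inv_part X \<theta> \<pi>\<^sub>2) (perm_conj X \<theta> \<pi>\<^sub>2 \<eta>)"
  using assms by (simp add: Gamma_def part_of_bar[OF two] block_map_of_star[OF two])

lemma is_functor_Gamma:
  "is_functor (partition_category X) (partition_category X) (Gamma X \<theta>)"
  unfolding is_functor_def
proof (intro conjI ballI impI)
  let ?P = "partition_category X" and ?G = "Gamma X \<theta>"
  show "category ?P" "category ?P" by (rule category_partition[OF two])+
  show "fobj ?G a \<in> obj ?P" if "a \<in> obj ?P" for a
    using that by (auto simp: obj_partition_category fobj_Gamma perm_inv_part_nonid)
  show "farr ?G f \<in> hom ?P (fobj ?G a) (fobj ?G b)" if "f \<in> hom ?P a b" for a b f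
    using that by (elim hom_partition_categoryE)
      (simp add: fobj_Gamma farr_Gamma hom_partition_category[OF two] perm_inv_part_nonid
        perm_conj_PiE)
  show "farr ?G (idt ?P a) = idt ?P (fobj ?G a)" if "a \<in> obj ?P" for a
    using that by (auto simp: obj_partition_category idt_partition_category
        fobj_Gamma farr_Gamma perm_conj_id)
  show "farr ?G (cmp ?P f g) = cmp ?P (farr ?G f) (farr ?G g)"
    if fg: "f \<in> arr ?P" "g \<in> arr ?P" "tgt ?P f = src ?P g" for f g
  proof -
    obtain \<pi>\<^sub>1 \<pi>\<^sub>2 \<pi>\<^sub>3 \<eta> \<zeta> where \<pi>: "\<pi>\<^sub>1 \<in> nonid_partitions X" "\<pi>\<^sub>2 \<in> nonid_partitions X"
        "\<pi>\<^sub>3 \<in> nonid_partitions X" "f = star X \<pi>\<^sub>1 \<pi>\<^sub>2 \<eta>" "g = star X \<pi>\<^sub>2 \<pi>\<^sub>3 \<zeta>"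
      and \<eta>: "\<eta> \<in> \<pi>\<^sub>2 \<rightarrow>\<^sub>E \<pi>\<^sub>1" "\<zeta> \<in> \<pi>\<^sub>3 \<rightarrow>\<^sub>E \<pi>\<^sub>2"
      using fg by (auto simp: partition_category_def dest!: bar_inject[OF two])
    then show ?thesis
      by (simp add: cmp_partition_category farr_Gamma compose_PiE perm_conj_PiE
          perm_conj_compose)
  qed
qed

text \<open>Block maps parametrise both hom-sets bijectively through \<open>star\<close>, and in
  these parameters the functor is \<open>perm_conj\<close>.\<close>

lemma fully_faithful_Gamma:
  "fully_faithful (partition_category X) (partition_category X) (Gamma X \<theta>)"
  unfolding fully_faithful_def obj_partition_category
proof (clarify)
  fix \<pi>\<^sub>1 \<pi>\<^sub>2 assume \<pi>: "\<pi>\<^sub>1 \<in> nonid_partitions X" "\<pi>\<^sub>2 \<in> nonid_partitions X"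
  let ?\<rho>\<^sub>1 = "perm_inv_part X \<theta> \<pi>\<^sub>1" and ?\<rho>\<^sub>2 = "perm_inv_part X \<theta> \<pi>\<^sub>2"
  have star: "bij_betw (star X \<rho>\<^sub>1 \<rho>\<^sub>2) (\<rho>\<^sub>2 \<rightarrow>\<^sub>E \<rho>\<^sub>1) (star X \<rho>\<^sub>1 \<rho>\<^sub>2 ` (\<rho>\<^sub>2 \<rightarrow>\<^sub>E \<rho>\<^sub>1))" for \<rho>\<^sub>1 \<rho>\<^sub>2
    by (intro bij_betw_imageI inj_onI refl) (rule star_inject[OF two])
  have "bij_betw (star X ?\<rho>\<^sub>1 ?\<rho>\<^sub>2 \<circ> perm_conj X \<theta> \<pi>\<^sub>2) (\<pi>\<^sub>2 \<rightarrow>\<^sub>E \<pi>\<^sub>1)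
      (star X ?\<rho>\<^sub>1 ?\<rho>\<^sub>2 ` (?\<rho>\<^sub>2 \<rightarrow>\<^sub>E ?\<rho>\<^sub>1))"
    by (rule bij_betw_trans[OF bij_betw_perm_conj[OF \<pi>] star])
  \<comment> \<open>On block maps, \<open>star\<close> followed by \<open>farr\<close> agrees with
    conjugation followed by \<open>star\<close>; the bijection \<open>star\<close> on the source
    side is cancelled afterwards.\<close>
  then have "bij_betw (farr (Gamma X \<theta>) \<circ> star X \<pi>\<^sub>1 \<pi>\<^sub>2) (\<pi>\<^sub>2 \<rightarrow>\<^sub>E \<pi>\<^sub>1)
      (star X ?\<rho>\<^sub>1 ?\<rho>\<^sub>2 ` (?\<rho>\<^sub>2 \<rightarrow>\<^sub>E ?\<rho>\<^sub>1))"
    by (rule bij_betw_cong[THEN iffD1, rotated]) (simp add: farr_Gamma[OF \<pi>])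
  then have "bij_betw (farr (Gamma X \<theta>)) (star X \<pi>\<^sub>1 \<pi>\<^sub>2 ` (\<pi>\<^sub>2 \<rightarrow>\<^sub>E \<pi>\<^sub>1))
      (star X ?\<rho>\<^sub>1 ?\<rho>\<^sub>2 ` (?\<rho>\<^sub>2 \<rightarrow>\<^sub>E ?\<rho>\<^sub>1))"
    by (rule bij_betw_comp_iff[OF star, THEN iffD2])
  then show "bij_betw (farr (Gamma X \<theta>)) (hom (partition_category X) (bar X \<pi>\<^sub>1) (bar X \<pi>\<^sub>2))
      (hom (partition_category X) (fobj (Gamma X \<theta>) (bar X \<pi>\<^sub>1)) (fobj (Gamma X \<theta>) (bar X \<pi>\<^sub>2)))"
    using \<pi> by (simp add: fobj_Gamma hom_partition_category[OF two] perm_inv_part_nonid)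
qed

lemma local_isomorphism_Gamma:
  "local_isomorphism (partition_category X) (partition_category X) (Gamma X \<theta>)"
proof (rule local_isomorphism_if_iso)
  let ?P = "partition_category X" and ?G = "Gamma X \<theta>"
  show "category_with_subobjects ?P" "category_with_subobjects ?P"
    by (rule category_with_subobjects_partition[OF two])+
  show "is_functor ?P ?P ?G" by (rule is_functor_Gamma)
  show "fully_faithful ?P ?P ?G" by (rule fully_faithful_Gamma)
  show "inclusion_preserving ?P ?P ?G"
    unfolding inclusion_preserving_def obj_partition_category
    by (auto simp: fobj_Gamma sub_partition_category[OF two] incl_partition_category[OF two]
        refines_perm_inv_part perm_inv_part_nonid farr_Gamma block_incl_PiE perm_conj_block_incl)
  show "sub ?P a b" if "a \<in> obj ?P" "b \<in> obj ?P" "sub ?P (fobj ?G a) (fobj ?G b)" for a b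
    using that by (auto simp: obj_partition_category fobj_Gamma refines_perm_inv_part
        sub_partition_category[OF two] perm_inv_part_nonid)
  have bar: "bij_betw (bar X) (nonid_partitions X) (obj ?P)"
    unfolding obj_partition_category
    by (intro bij_betw_imageI inj_onI refl) (rule bar_inject[OF two])
  \<comment> \<open>The object map is read through the bijection \<open>bar X\<close>, under which
    it becomes \<open>perm_inv_part X \<theta>\<close>.\<close>
  have "bij_betw (bar X \<circ> perm_inv_part X \<theta>) (nonid_partitions X) (obj ?P)"
    by (rule bij_betw_trans[OF bij_betw_perm_inv_part bar])
  then have "bij_betw (fobj ?G \<circ> bar X) (nonid_partitions X) (obj ?P)"
    by (rule bij_betw_cong[THEN iffD1, rotated]) (simp add: fobj_Gamma)
  then show "bij_betw (fobj ?G) (obj ?P) (obj ?P)"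
    by (rule bij_betw_comp_iff[OF bar, THEN iffD2])
qed

end

end

text \<open>Lump the complement of \<open>A\<close> together with one point of \<open>A\<close>.\<close>

lemma exists_partition_with_cross_section:
  assumes "A \<subseteq> X" "A \<noteq> {}" "A \<noteq> X"
  shows "\<exists>\<pi> \<in> nonid_partitions X. \<forall>B \<in> \<pi>. \<exists>!x. x \<in> A \<and> x \<in> B"
proof -
  obtain a where a: "a \<in> A" using assms by blast
  obtain z where z: "z \<in> X" "z \<notin> A" using assms by blast
  let ?B = "insert a (X - A)" and ?\<pi> = "insert (insert a (X - A)) ((\<lambda>x. {x}) ` (A - {a}))"
  have "partition_on X ?\<pi>"
  proof (rule partition_onI)
    show "\<Union>?\<pi> = X" using assms(1) a by auto
    show "disjnt p q" if "p \<in> ?\<pi>" "q \<in> ?\<pi>" "p \<noteq> q" for p q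
      using that by (auto simp: disjnt_def)
  qed auto
  \<comment> \<open>The lump has two distinct points because \<open>A\<close> is proper, which makes
    the partition non-identity.\<close>
  moreover have "a \<in> ?B" "z \<in> ?B" "a \<noteq> z" using a z by auto
  then have "\<exists>x \<in> ?B. \<exists>y \<in> ?B. x \<noteq> y" by blast
  ultimately have "?\<pi> \<in> nonid_partitions X" by (simp add: nonid_partitions_def)
  moreover have "\<exists>!x. x \<in> A \<and> x \<in> B" if "B \<in> ?\<pi>" for B
  proof (cases "B = ?B")
    case True
    with a show ?thesis by (intro ex1I[of _ a]) auto
  next
    case False
    with that obtain x where "x \<in> A" "B = {x}" by blast
    then show ?thesis by (intro ex1I[of _ x]) auto
  qed
  ultimately show ?thesis by (intro bexI[of _ ?\<pi>] ballI)
qed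

theorem lemma4p8:
  fixes X :: "'a set" and \<theta> :: "'a \<Rightarrow> 'a"
  assumes "\<exists>x \<in> X. \<exists>y \<in> X. x \<noteq> y"
    and "bij_betw \<theta> X X"
  shows "(\<forall>\<pi> \<in> nonid_partitions X.
            fobj (Gamma X \<theta>) (bar X \<pi>) = bar X (perm_inv_part X \<theta> \<pi>)) \<and>
         (\<forall>\<pi>\<^sub>1 \<in> nonid_partitions X. \<forall>\<pi>\<^sub>2 \<in> nonid_partitions X. \<forall>\<eta> \<in> \<pi>\<^sub>2 \<rightarrow>\<^sub>E \<pi>\<^sub>1.
            farr (Gamma X \<theta>) (star X \<pi>\<^sub>1 \<pi>\<^sub>2 \<eta>) =
              star X (perm_inv_part X \<theta> \<pi>\<^sub>1) (perm_inv_part X \<theta> \<pi>\<^sub>2) (perm_conj X \<theta> \<pi>\<^sub>2 \<eta>)) \<and>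
         cross_connection (partition_category X) (powerset_category X)
           (partition_category X) (M_set X) (Gamma X \<theta>)"
proof -
  have "\<exists>d \<in> obj (partition_category X). A \<in> M_set X (fobj (Gamma X \<theta>) d)"
    if "A \<in> obj (powerset_category X)" for A
  proof -
    have A: "A \<subseteq> X" "A \<noteq> {}" "A \<noteq> X" using that by (auto simp: powerset_category_def)
    obtain \<rho> where \<rho>: "\<rho> \<in> nonid_partitions X" "\<forall>B \<in> \<rho>. \<exists>!x. x \<in> A \<and> x \<in> B"
      using exists_partition_with_cross_section[OF A] by blast
    \<comment> \<open>The cross-section belongs to \<open>\<rho>\<close>, so \<open>\<rho>\<close>
      is pulled back to a \<open>\<pi>\<close> whose image under the functor is
      \<open>bar X \<rho>\<close>.\<close>
    obtain \<pi> where \<pi>: "\<pi> \<in> nonid_partitions X" "\<rho> = perm_inv_part X \<theta> \<pi>"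
      using \<rho>(1) bij_betw_perm_inv_part[OF assms(2)] by (auto simp: bij_betw_def)
    have "A \<in> M_set X (fobj (Gamma X \<theta>) (bar X \<pi>))"
      using A \<rho> \<pi> assms by (simp add: fobj_Gamma M_set_def part_of_bar)
    then show ?thesis
      using \<pi>(1) by (auto simp: obj_partition_category)
  qed
  then show ?thesis
    using assms by (simp add: cross_connection_def fobj_Gamma farr_Gamma local_isomorphism_Gamma
        category_with_subobjects_powerset)
qed

end
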